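(* Let $q=p^m$ with $p$ prime, let $T:\mathbb{F}_q^3\rightarrow\mathbb{F}_q$ and $\theta:\mathbb{F}_q^3\rightarrow\mathrm{Aut}(\mathbb{F}_q)$ be two functions, write $\theta_{a,b,c}:=\theta(a,b,c)$, and set $\mathfrak{g}_{a,b,c}:=(E(a,b,c,T(a,b,c)),\,\theta_{a,b,c})$ and $G:=\{\mathfrak{g}_{a,b,c}:\,a,b,c\in\mathbb{F}_q\}$. Then $G$ is a group acting regularly on the points of the Payne derived quadrangle $\mathcal{Q}^P$ if and only if for all triples $(a,b,c)$ and $(x,y,z)$ in $\mathbb{F}_q^3$ we have $\mathfrak{g}_{a,b,c}\circ\mathfrak{g}_{x,y,z}=\mathfrak{g}_{u,v,w}$, which is equivalent to $$\theta_{a,b,c}\theta_{x,y,z}=\theta_{u,v,w},\qquad T(a,b,c)^{\theta_{x,y,z}}+T(x,y,z)=T(u,v,w),$$ where $w=c^{\theta_{x,y,z}}+z$, $v=b^{\theta_{x,y,z}}+y+c^{\theta_{x,y,z}}T(x,y,z)$ and $u=a^{\theta_{x,y,z}}+x-b^{\theta_{x,y,z}}z+c^{\theta_{x,y,z}}y-c^{\theta_{x,y,z}}zT(x,y,z)$.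
   Context: Let $V=\mathbb{F}_q^4$ carry the alternating form $(x,y)=x_1y_4-x_4y_1+x_2y_3-x_3y_2$, and let $W(q)$ be the symplectic generalized quadrangle whose points are all points of $\mathrm{PG}(3,q)$ and whose lines are the totally isotropic lines. Let $P=\langle(1,0,0,0)\rangle$. The Payne derived quadrangle $\mathcal{Q}^P$ has as points the projective points not in $P^\perp$, namely $\langle(a,b,c,1)\rangle$, $a,b,c\in\mathbb{F}_q$, and as lines the totally isotropic lines not containing $P$ together with the lines $\langle P,Q\rangle$ with $Q\notin P^\perp$. For $a,b,c,t\in\mathbb{F}_q$ let $E(a,b,c,t)$ be the $4\times4$ matrix over $\mathbb{F}_q$ with rows $(1,0,0,0)$, $(-c,1,0,0)$, $(b-ct,t,1,0)$, $(a,b,c,1)$. A pair $(A,\sigma)$ with $A\in\mathrm{GL}(4,q)$, $\sigma\in\mathrm{Aut}(\mathbb{F}_q)$ denotes the semilinear map $x\mapsto x^{\sigma}A$ on row vectors (with $x^\sigma$ obtained by applying $\sigma$ to each coordinate), acting on projective points; each $\mathfrak{g}_{a,b,c}$ lies in the stabilizer of $P$ in $\mathrm{P\Gamma Sp}(4,q)$ and so acts on $\mathcal{Q}^P$. Composition is $(A_1,\sigma_1)\circ(A_2,\sigma_2)=(A_1^{\sigma_2}A_2,\sigma_1\sigma_2)$, where $A^{\sigma}$ applies $\sigma$ to each entry of $A$. The element $\mathfrak{g}_{a,b,c}$ maps $\langle(0,0,0,1)\rangle$ to $\langle(a,b,c,1)\rangle$. *)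

theory Defs
  imports "HOL-Analysis.Cartesian_Space" "HOL-Algebra.Group" "HOL-Computational_Algebra.Primes"
begin

definition field_auts :: "('a::field \<Rightarrow> 'a) set" where
  "field_auts = {\<sigma>. bij \<sigma> \<and> \<sigma> 1 = 1 \<and>
     (\<forall>x y. \<sigma> (x + y) = \<sigma> x + \<sigma> y) \<and> (\<forall>x y. \<sigma> (x * y) = \<sigma> x * \<sigma> y)}"

(* The product in Aut(F_q) follows exponent notation, x^(\<sigma>\<tau>) = (x^\<sigma>)^\<tau>. *)
definition aut_mult :: "('a \<Rightarrow> 'a) \<Rightarrow> ('a \<Rightarrow> 'a) \<Rightarrow> 'a \<Rightarrow> 'a" where
  "aut_mult \<sigma> \<tau> = \<tau> \<circ> \<sigma>"


subsection \<open>The symplectic quadrangle and its Payne derivation\<close>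

(* Points and lines of PG(3,q) are the subspaces of F_q^4 of dimension 1 and 2;
   incidence is inclusion. *)

definition symp_form :: "'a::field ^ 4 \<Rightarrow> 'a ^ 4 \<Rightarrow> 'a" where
  "symp_form x y = x $ 1 * y $ 4 - x $ 4 * y $ 1 + x $ 2 * y $ 3 - x $ 3 * y $ 2"

definition perp :: "('a::field ^ 4) set \<Rightarrow> ('a ^ 4) set" where
  "perp S = {y. \<forall>x\<in>S. symp_form x y = 0}"

definition proj_points :: "('a::field ^ 4) set set" where
  "proj_points = {S. vec.subspace S \<and> vec.dim S = 1}"

definition proj_lines :: "('a::field ^ 4) set set" where
  "proj_lines = {S. vec.subspace S \<and> vec.dim S = 2}"

definition W_lines :: "('a::field ^ 4) set set" where
  "W_lines = {L \<in> proj_lines. \<forall>x\<in>L. \<forall>y\<in>L. symp_form x y = 0}"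

definition base_point :: "('a::field ^ 4) set" where
  "base_point = vec.span {vector [1, 0, 0, 0]}"

definition payne_points :: "('a::field ^ 4) set set" where
  "payne_points = {Q \<in> proj_points. \<not> Q \<subseteq> perp base_point}"

definition payne_lines :: "('a::field ^ 4) set set" where
  "payne_lines = {L \<in> W_lines. \<not> base_point \<subseteq> L} \<union>
     {vec.span (base_point \<union> Q) | Q. Q \<in> proj_points \<and> \<not> Q \<subseteq> perp base_point}"


subsection \<open>Semilinear maps\<close>

type_synonym 'a semilinear = "('a ^ 4 ^ 4) \<times> ('a \<Rightarrow> 'a)"

definition semilin_apply :: "'a::field semilinear \<Rightarrow> 'a ^ 4 \<Rightarrow> 'a ^ 4" where
  "semilin_apply g x = (\<chi> i. snd g (x $ i)) v* fst g"

definition semilin_comp :: "'a::field semilinear \<Rightarrow> 'a semilinear \<Rightarrow> 'a semilinear" where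
  "semilin_comp g h = (map_matrix (snd h) (fst g) ** fst h, aut_mult (snd g) (snd h))"

definition GammaL4 :: "'a::field semilinear monoid" where
  "GammaL4 = \<lparr>carrier = {(A, \<sigma>). invertible A \<and> \<sigma> \<in> field_auts},
     monoid.mult = semilin_comp, one = (mat 1, id)\<rparr>"

definition subspace_act :: "'a::field semilinear \<Rightarrow> ('a ^ 4) set \<Rightarrow> ('a ^ 4) set" where
  "subspace_act g S = semilin_apply g ` S"

definition payne_automorphism :: "'a::field semilinear \<Rightarrow> bool" where
  "payne_automorphism g \<longleftrightarrow>
     bij_betw (subspace_act g) payne_points payne_points \<and>
     bij_betw (subspace_act g) payne_lines payne_lines"

(* The action is a right action: semilin_comp g h first applies g
   (see subspace_act_comp below). *)
definition point_regular_group :: "'a::field semilinear set \<Rightarrow> bool" where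
  "point_regular_group G \<longleftrightarrow>
     subgroup G GammaL4 \<and>
     (\<forall>g\<in>G. payne_automorphism g) \<and>
     (\<forall>X\<in>payne_points. \<forall>Y\<in>payne_points. \<exists>g\<in>G. subspace_act g X = Y) \<and>
     (\<forall>X\<in>payne_points. \<forall>g\<in>G. subspace_act g X = X \<longrightarrow> g = \<one>\<^bsub>GammaL4\<^esub>)"

definition E_mat :: "'a::field \<Rightarrow> 'a \<Rightarrow> 'a \<Rightarrow> 'a \<Rightarrow> 'a ^ 4 ^ 4" where
  "E_mat a b c t = vector
     [vector [1,         0, 0, 0],
      vector [- c,       1, 0, 0],
      vector [b - c * t, t, 1, 0],
      vector [a,         b, c, 1]]"

definition g_elem ::
  "('a::field \<times> 'a \<times> 'a \<Rightarrow> 'a) \<Rightarrow> ('a \<times> 'a \<times> 'a \<Rightarrow> 'a \<Rightarrow> 'a) \<Rightarrow> 'a \<times> 'a \<times> 'a \<Rightarrow> 'a semilinear"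
where
  "g_elem T \<theta> = (\<lambda>(a, b, c). (E_mat a b c (T (a, b, c)), \<theta> (a, b, c)))"

definition G_set ::
  "('a::field \<times> 'a \<times> 'a \<Rightarrow> 'a) \<Rightarrow> ('a \<times> 'a \<times> 'a \<Rightarrow> 'a \<Rightarrow> 'a) \<Rightarrow> 'a semilinear set"
where
  "G_set T \<theta> = {g_elem T \<theta> (a, b, c) | a b c. True}"


subsection \<open>Sanity checks\<close>

lemma vector_4 [simp]:
  "(vector [a, b, c, d] :: 'a::zero ^ 4) $ 1 = a"
  "(vector [a, b, c, d] :: 'a::zero ^ 4) $ 2 = b"
  "(vector [a, b, c, d] :: 'a::zero ^ 4) $ 3 = c"
  "(vector [a, b, c, d] :: 'a::zero ^ 4) $ 4 = d"
  unfolding vector_def by simp_all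

lemma field_autsD:
  assumes "\<sigma> \<in> field_auts"
  shows "bij \<sigma>" "\<sigma> 0 = 0" "\<sigma> 1 = 1" "\<sigma> (x + y) = \<sigma> x + \<sigma> y" "\<sigma> (x * y) = \<sigma> x * \<sigma> y"
    "\<sigma> (sum f A) = (\<Sum>i\<in>A. \<sigma> (f i))"
proof -
  have add: "\<sigma> (x + y) = \<sigma> x + \<sigma> y" for x y using assms by (simp add: field_auts_def)
  have z: "\<sigma> 0 = 0" using add[of 0 0] by (metis add_0_right add_left_cancel)
  show "bij \<sigma>" "\<sigma> 0 = 0" "\<sigma> 1 = 1" "\<sigma> (x + y) = \<sigma> x + \<sigma> y" "\<sigma> (x * y) = \<sigma> x * \<sigma> y"
    using assms z by (simp_all add: field_auts_def)
  show "\<sigma> (sum f A) = (\<Sum>i\<in>A. \<sigma> (f i))"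
    by (induction A rule: infinite_finite_induct) (simp_all add: z add)
qed

lemma semilin_apply_comp:
  assumes "snd h \<in> field_auts"
  shows "semilin_apply (semilin_comp g h) x = semilin_apply h (semilin_apply g x)"
  using field_autsD[OF assms]
  by (simp add: semilin_apply_def semilin_comp_def aut_mult_def vec_eq_iff vector_matrix_mult_def
      matrix_matrix_mult_def sum_4 algebra_simps)

lemma subspace_act_comp:
  assumes "snd h \<in> field_auts"
  shows "subspace_act (semilin_comp g h) S = subspace_act h (subspace_act g S)"
  using semilin_apply_comp[OF assms] by (simp add: subspace_act_def image_image)

lemma map_matrix_mult:
  assumes "\<sigma> \<in> field_auts"
  shows "map_matrix \<sigma> (A ** B) = map_matrix \<sigma> A ** map_matrix \<sigma> (B :: 'a::field ^ 4 ^ 4)"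
  using field_autsD[OF assms] by (simp add: vec_eq_iff matrix_matrix_mult_def sum_4)

lemma map_matrix_one:
  assumes "\<sigma> \<in> field_auts"
  shows "map_matrix \<sigma> (mat 1 :: 'a::field ^ 4 ^ 4) = mat 1"
  using field_autsD[OF assms] by (simp add: vec_eq_iff mat_def)

lemma invertible_map_matrix:
  assumes "\<sigma> \<in> field_auts" "invertible (A :: 'a::field ^ 4 ^ 4)"
  shows "invertible (map_matrix \<sigma> A)"
  using assms(2) unfolding invertible_def
  by (metis map_matrix_mult[OF assms(1)] map_matrix_one[OF assms(1)])

lemma field_auts_comp: "\<sigma> \<in> field_auts \<Longrightarrow> \<tau> \<in> field_auts \<Longrightarrow> aut_mult \<sigma> \<tau> \<in> field_auts"
  by (auto simp: field_auts_def aut_mult_def bij_comp)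

lemma field_auts_inv:
  assumes "\<sigma> \<in> field_auts"
  shows "Hilbert_Choice.inv \<sigma> \<in> field_auts"
proof -
  let ?i = "Hilbert_Choice.inv \<sigma>"
  note D = field_autsD[OF assms]
  have i: "?i (\<sigma> x) = x" "\<sigma> (?i x) = x" for x
    using D(1) by (simp_all add: bij_is_inj bij_is_surj surj_f_inv_f)
  have "?i (x + y) = ?i x + ?i y" "?i (x * y) = ?i x * ?i y" "?i 1 = 1" for x y
    by (metis D(4) i) (metis D(5) i, metis D(3) i)
  then show ?thesis
    using D(1) by (simp add: field_auts_def bij_imp_bij_inv)
qed

lemma group_GammaL4: "group (GammaL4 :: 'a::field semilinear monoid)"
proof (rule groupI)
  show "x \<otimes>\<^bsub>GammaL4\<^esub> y \<in> carrier GammaL4"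
    if "x \<in> carrier GammaL4" "y \<in> carrier GammaL4" for x y :: "'a semilinear"
    using that
    by (auto simp: GammaL4_def semilin_comp_def field_auts_comp invertible_map_matrix invertible_mult)
  show "\<one>\<^bsub>GammaL4\<^esub> \<in> carrier (GammaL4 :: 'a semilinear monoid)"
    by (auto simp: GammaL4_def field_auts_def invertible_def)
  show "x \<otimes>\<^bsub>GammaL4\<^esub> y \<otimes>\<^bsub>GammaL4\<^esub> z = x \<otimes>\<^bsub>GammaL4\<^esub> (y \<otimes>\<^bsub>GammaL4\<^esub> z)"
    if "x \<in> carrier GammaL4" "y \<in> carrier GammaL4" "z \<in> carrier GammaL4" for x y z :: "'a semilinear"
    using that
    by (auto simp: GammaL4_def semilin_comp_def aut_mult_def map_matrix_mult matrix_mul_assoc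
        comp_assoc) (simp add: map_matrix_def)
  show "\<one>\<^bsub>GammaL4\<^esub> \<otimes>\<^bsub>GammaL4\<^esub> x = x" if "x \<in> carrier GammaL4" for x :: "'a semilinear"
    using that by (auto simp: GammaL4_def semilin_comp_def aut_mult_def map_matrix_one)
  show "\<exists>y\<in>carrier GammaL4. y \<otimes>\<^bsub>GammaL4\<^esub> x = \<one>\<^bsub>GammaL4\<^esub>"
    if x: "x \<in> carrier GammaL4" for x :: "'a semilinear"
  proof -
    obtain A \<sigma> where A: "x = (A, \<sigma>)" "invertible A" "\<sigma> \<in> field_auts"
      using x by (auto simp: GammaL4_def)
    obtain B where B: "A ** B = mat 1" "B ** A = mat 1" using A(2) by (auto simp: invertible_def)
    let ?i = "Hilbert_Choice.inv \<sigma>"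
    have i: "?i \<in> field_auts" by (rule field_auts_inv[OF A(3)])
    have s: "\<sigma> (?i x) = x" for x
      using field_autsD(1)[OF A(3)] by (simp add: bij_is_surj surj_f_inv_f)
    have "invertible B" using B by (auto simp: invertible_def)
    then have "invertible (map_matrix ?i B)" by (rule invertible_map_matrix[OF i])
    moreover have "map_matrix \<sigma> (map_matrix ?i B) = B" by (simp add: vec_eq_iff s)
    moreover have "\<sigma> \<circ> ?i = id" using s by auto
    ultimately show ?thesis
      using A B i
      by (intro bexI[of _ "(map_matrix ?i B, ?i)"]) (auto simp: GammaL4_def semilin_comp_def aut_mult_def)
  qed
qed

lemma g_elem_in_GammaL4:
  assumes "\<theta> r \<in> field_auts"
  shows "g_elem T \<theta> r \<in> carrier GammaL4"
proof -
  obtain a b c where r: "r = (a, b, c)" by (cases r)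
  let ?t = "T r"
  let ?B = "E_mat (- a - b * c + c * (b - c * ?t) + c * c * ?t) (- b + c * ?t) (- c) (- ?t)"
  have "E_mat a b c ?t ** ?B = mat 1" "?B ** E_mat a b c ?t = mat 1"
    by (simp_all add: vec_eq_iff forall_4 E_mat_def matrix_matrix_mult_def sum_4 mat_def algebra_simps)
  then have "invertible (E_mat a b c ?t)" by (auto simp: invertible_def)
  then show ?thesis using assms by (simp add: g_elem_def r GammaL4_def)
qed

lemma semilin_apply_axis: "\<sigma> \<in> field_auts \<Longrightarrow> semilin_apply (A, \<sigma>) (axis i 1) = row i A"
  using field_autsD(2,3)[of \<sigma>]
  by (simp add: semilin_apply_def vec_eq_iff vector_matrix_mult_def row_def axis_def if_distrib
      if_distribR cong: if_cong)

lemma GammaL4_act_faithful: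
  fixes g h :: "'a::field semilinear"
  assumes g: "g \<in> carrier GammaL4" and h: "h \<in> carrier GammaL4"
    and corner: "fst g $ 1 $ 1 = 1" "fst h $ 1 $ 1 = 1"
    and act: "\<And>X. X \<in> proj_points \<Longrightarrow> subspace_act g X = subspace_act h X"
  shows "g = h"
proof -
  obtain A \<sigma> where A: "g = (A, \<sigma>)" "\<sigma> \<in> field_auts" using g by (auto simp: GammaL4_def)
  obtain B \<tau> where B: "h = (B, \<tau>)" "\<tau> \<in> field_auts" "invertible B" using h by (auto simp: GammaL4_def)
  obtain C where C: "B ** C = mat 1" using B(3) by (auto simp: invertible_def)
  have lin: "semilin_apply (M, \<rho>) (x + s *s y) = semilin_apply (M, \<rho>) x + \<rho> s *s semilin_apply (M, \<rho>) y"
    if "\<rho> \<in> field_auts" for M \<rho> s and x y :: "'a ^ 4"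
    using field_autsD(4,5)[OF that]
    by (simp add: semilin_apply_def vec_eq_iff vector_matrix_mult_def sum_4 algebra_simps)
  have ex: "\<exists>\<mu>. semilin_apply g x = \<mu> *s semilin_apply h x" if "x \<noteq> 0" for x
  proof -
    have "vec.dim (vec.span {x}) = 1"
      using that by (simp add: vec.dim_eq_card_independent)
    then have "vec.span {x} \<in> proj_points" by (simp add: proj_points_def)
    then have "semilin_apply g x \<in> subspace_act h (vec.span {x})"
      using act vec.span_base[of x "{x}"] by (auto simp: subspace_act_def)
    then obtain k where "semilin_apply g x = semilin_apply h (0 + k *s x)"
      by (auto simp: subspace_act_def vec.span_singleton)
    also have "\<dots> = \<tau> k *s semilin_apply h x"
      unfolding B(1) lin[OF B(2)]
      using field_autsD(2)[OF B(2)] by (simp add: semilin_apply_def vec_eq_iff vector_matrix_mult_def)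
    finally show ?thesis by blast
  qed
  have "\<exists>\<mu>. row i A = \<mu> *s row i B" for i
  proof -
    have "axis i 1 \<noteq> (0 :: 'a ^ 4)" by (simp add: axis_eq_0_iff)
    from ex[OF this] show ?thesis by (simp add: A B(1,2) semilin_apply_axis)
  qed
  then obtain \<mu> where mu: "\<And>i. row i A = \<mu> i *s row i B" by metis
  have ind: "\<alpha> = \<alpha>' \<and> \<beta> = \<beta>'"
    if "i \<noteq> j" "\<alpha> *s row i B + \<beta> *s row j B = \<alpha>' *s row i B + \<beta>' *s row j B" for i j \<alpha> \<beta> \<alpha>' \<beta>'
  proof -
    have r: "row k B v* C = axis k 1" for k
    proof -
      have "row k B v* C = row k (B ** C)"
        by (simp add: vec_eq_iff vector_matrix_mult_def matrix_matrix_mult_def row_def mult.commute)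
      also have "\<dots> = axis k 1"
        unfolding C by (auto simp: vec_eq_iff row_def mat_def axis_def)
      finally show ?thesis .
    qed
    have "(\<alpha> *s row i B + \<beta> *s row j B) v* C = \<alpha> *s axis i 1 + \<beta> *s axis j 1" for \<alpha> \<beta>
      unfolding r[symmetric] by (simp add: vec_eq_iff vector_matrix_mult_def sum_4 algebra_simps)
    then have "\<alpha> *s axis i 1 + \<beta> *s axis j 1 = \<alpha>' *s axis i 1 + \<beta>' *s axis j (1::'a)"
      using that(2) by metis
    then have *: "(\<alpha> *s axis i 1 + \<beta> *s axis j 1) $ k = (\<alpha>' *s axis i 1 + \<beta>' *s axis j (1::'a)) $ k" for k
      by simp
    show ?thesis using *[of i] *[of j] that(1) by (auto simp: axis_def)
  qed
  have key: "\<sigma> s * \<mu> j = \<mu> i * \<tau> s" if "i \<noteq> j" for i j s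
  proof -
    have "(axis i 1 + s *s axis j 1) $ i = (1::'a)" using that by (simp add: axis_def)
    then have "axis i 1 + s *s axis j 1 \<noteq> (0 :: 'a ^ 4)" by (metis zero_index zero_neq_one)
    from ex[OF this] obtain \<nu> where
      "semilin_apply g (axis i 1 + s *s axis j 1) = \<nu> *s semilin_apply h (axis i 1 + s *s axis j 1)" ..
    then have "row i A + \<sigma> s *s row j A = \<nu> *s (row i B + \<tau> s *s row j B)"
      by (simp add: A B lin semilin_apply_axis)
    then have "\<mu> i *s row i B + (\<sigma> s * \<mu> j) *s row j B = \<nu> *s row i B + (\<nu> * \<tau> s) *s row j B"
      by (simp add: mu vec_eq_iff algebra_simps)
    from ind[OF that this] show ?thesis by simp
  qed
  have "row 1 A $ 1 = (\<mu> 1 *s row 1 B) $ 1"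
    by (simp only: mu)
  then have one: "\<mu> 1 = 1"
    using corner by (simp add: A(1) B(1) row_def)
  have all: "\<mu> j = 1" for j
    using key[of 1 j 1] one field_autsD(3)[OF A(2)] field_autsD(3)[OF B(2)] by (cases "j = 1") auto
  have "A $ i = B $ i" for i
    using mu[of i] unfolding all row_def by simp
  then have "A = B" by (simp add: vec_eq_iff)
  moreover have "\<sigma> s = \<tau> s" for s
    using key[of 1 2 s] unfolding all by simp
  then have "\<sigma> = \<tau>" by auto
  ultimately show ?thesis by (simp only: A(1) B(1))
qed

(* Elements of G may thus be read as collineations in PGammaL(4,q) just as well as
   semilinear maps: scalars do not affect which products lie in G. *)
lemma g_elem_comp_eq_iff_act_eq:
  fixes T :: "'a::field \<times> 'a \<times> 'a \<Rightarrow> 'a"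
  assumes "\<And>r. \<theta> r \<in> field_auts"
  shows "semilin_comp (g_elem T \<theta> r) (g_elem T \<theta> s) = g_elem T \<theta> t \<longleftrightarrow>
    (\<forall>X\<in>proj_points. subspace_act (semilin_comp (g_elem T \<theta> r) (g_elem T \<theta> s)) X
       = subspace_act (g_elem T \<theta> t) X)"
proof
  have "semilin_comp (g_elem T \<theta> r) (g_elem T \<theta> s) \<in> carrier GammaL4"
    using monoid.m_closed[OF group.is_monoid[OF group_GammaL4] g_elem_in_GammaL4 g_elem_in_GammaL4,
        of \<theta> r \<theta> s T T, OF assms assms]
    unfolding GammaL4_def monoid.simps .
  moreover have "fst (semilin_comp (g_elem T \<theta> r) (g_elem T \<theta> s)) $ 1 $ 1 = 1"
    using field_autsD(2,3)[OF assms[of s]]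
    by (cases r; cases s)
      (simp add: semilin_comp_def g_elem_def E_mat_def matrix_matrix_mult_def sum_4)
  moreover have "fst (g_elem T \<theta> t) $ 1 $ 1 = 1"
    by (cases t) (simp add: g_elem_def E_mat_def)
  ultimately show "semilin_comp (g_elem T \<theta> r) (g_elem T \<theta> s) = g_elem T \<theta> t"
    if "\<forall>X\<in>proj_points. subspace_act (semilin_comp (g_elem T \<theta> r) (g_elem T \<theta> s)) X
       = subspace_act (g_elem T \<theta> t) X"
    using that by (intro GammaL4_act_faithful g_elem_in_GammaL4 assms) simp_all
qed simp

end

theory Submission
  imports Defs
begin

text \<open>The product of two matrices \<^term>\<open>E_mat a b c t\<close> and \<^term>\<open>E_mat x y z s\<close> (the first
  one twisted by an automorphism) is again of this form, and its fourth row determines its first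
  three parameters; comparing the fourth parameter gives the functional equations. If the set
  \<open>{g\<^bsub>a,b,c\<^esub>}\<close> is closed under composition, then it is a group because it is finite, and it
  carries the point \<open>\<langle>(0, 0, 0, 1)\<rangle>\<close> to every point exactly once, which is regularity.\<close>

section \<open>Products and isometry of the matrices \<open>E_mat a b c t\<close>\<close>

lemma field_auts_minus: "\<sigma> \<in> field_auts \<Longrightarrow> \<sigma> (- r) = - \<sigma> r"
  using field_autsD(2)[of \<sigma>] field_autsD(4)[of \<sigma> r "- r"]
  by (simp add: eq_neg_iff_add_eq_0 add.commute)

lemma field_auts_diff: "\<sigma> \<in> field_auts \<Longrightarrow> \<sigma> (r - s) = \<sigma> r - \<sigma> s"
  using field_autsD(4)[of \<sigma> r "- s"] by (simp add: field_auts_minus)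

lemma E_mat_eq_iff:
  "E_mat a b c t = E_mat a' b' c' t' \<longleftrightarrow> a = a' \<and> b = b' \<and> c = c' \<and> t = t'"
  by (auto simp: vec_eq_iff forall_4 E_mat_def)

text \<open>The first three parameters are the fourth row of the product, the image of the twisted
  affine vector. The fourth is the entry in row 3, column 2. The entry in row 3, column 1 then
  agrees automatically with the pattern of \<open>E_mat\<close>.\<close>

lemma semilin_comp_E_mat:
  assumes "\<sigma> \<in> field_auts"
  shows "semilin_comp (E_mat a b c t, \<rho>) (E_mat x y z s, \<sigma>) =
    (E_mat (\<sigma> a + x - \<sigma> b * z + \<sigma> c * y - \<sigma> c * z * s) (\<sigma> b + y + \<sigma> c * s) (\<sigma> c + z) (\<sigma> t + s),
     aut_mult \<rho> \<sigma>)"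
  by (simp add: semilin_comp_def vec_eq_iff forall_4 E_mat_def matrix_matrix_mult_def sum_4
      field_autsD[OF assms] field_auts_minus[OF assms] field_auts_diff[OF assms] algebra_simps)

text \<open>The entries \<open>- c\<close> and \<open>b - c * t\<close> are exactly those that make
  rows 2 and 3 orthogonal to row 4. The rows therefore have the same Gram matrix as the standard
  basis, for every \<open>t\<close>, and its entries 0, 1, -1 are fixed by \<sigma>.\<close>

lemma symp_form_E_mat:
  assumes "\<sigma> \<in> field_auts"
  shows "symp_form (semilin_apply (E_mat a b c t, \<sigma>) x) (semilin_apply (E_mat a b c t, \<sigma>) y)
    = \<sigma> (symp_form x y)"
  by (simp add: symp_form_def semilin_apply_def E_mat_def vector_matrix_mult_def sum_4
      field_autsD[OF assms] field_auts_diff[OF assms] algebra_simps)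

section \<open>Invertible semilinear maps on subspaces, and as automorphisms of the
  quadrangle\<close>

lemma semilin_apply_linear:
  assumes "snd g \<in> field_auts"
  shows "semilin_apply g (x + y) = semilin_apply g x + semilin_apply g y"
    and "semilin_apply g (k *s x) = snd g k *s semilin_apply g x"
    and "semilin_apply g 0 = 0"
  using field_autsD[OF assms]
  by (simp_all add: semilin_apply_def vec_eq_iff vector_matrix_mult_def sum_4 algebra_simps)

text \<open>Turns the inverse in the group \<open>GammaL4\<close> into an inverse map on vectors, so
  that any inclusion or inequality shown for all group elements can be reversed.\<close>

lemma GammaL4_inverse:
  assumes "g \<in> carrier GammaL4"
  obtains h where "h \<in> carrier GammaL4" "\<And>x. semilin_apply h (semilin_apply g x) = x"
    "\<And>x. semilin_apply g (semilin_apply h x) = x"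
proof -
  interpret group "GammaL4 :: 'a semilinear monoid" by (rule group_GammaL4)
  let ?h = "inv\<^bsub>GammaL4\<^esub> g"
  have aut: "snd k \<in> field_auts" if "k \<in> carrier GammaL4" for k :: "'a semilinear"
    using that by (auto simp: GammaL4_def)
  have h: "?h \<in> carrier GammaL4" using assms by simp
  have one: "semilin_apply (\<one>\<^bsub>GammaL4\<^esub>) x = x" for x :: "'a ^ 4"
    by (simp add: GammaL4_def semilin_apply_def vector_matrix_mult_def mat_def vec_eq_iff sum_4 forall_4)
  have mult: "semilin_comp = (\<otimes>\<^bsub>GammaL4\<^esub>)" by (simp add: GammaL4_def)
  have "semilin_apply ?h (semilin_apply g x) = x" "semilin_apply g (semilin_apply ?h x) = x" for x
    using semilin_apply_comp[OF aut[OF h], of g x] semilin_apply_comp[OF aut[OF assms], of ?h x] assms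
    unfolding mult by (simp_all add: one)
  then show thesis using that h by blast
qed

lemma inj_semilin_apply: "g \<in> carrier GammaL4 \<Longrightarrow> inj (semilin_apply g)"
  by (metis GammaL4_inverse injI)

lemma inj_subspace_act: "g \<in> carrier GammaL4 \<Longrightarrow> inj (subspace_act g)"
  by (rule injI) (metis inj_image_eq_iff inj_semilin_apply subspace_act_def)

lemma subspace_act_span_subset:
  assumes "snd g \<in> field_auts"
  shows "subspace_act g (vec.span S) \<subseteq> vec.span (subspace_act g S)"
proof -
  have "semilin_apply g x \<in> vec.span (semilin_apply g ` S)" if "x \<in> vec.span S" for x
    using that
    by (induction rule: vec.span_induct_alt)
      (simp_all add: semilin_apply_linear[OF assms] vec.span_zero vec.span_add vec.span_scale
        vec.span_base)
  then show ?thesis by (auto simp: subspace_act_def)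
qed

text \<open>Semilinearity gives one inclusion; the other is the same inclusion for the inverse map,
  carried back by \<open>g\<close>.\<close>

lemma subspace_act_span:
  assumes "g \<in> carrier GammaL4"
  shows "subspace_act g (vec.span S) = vec.span (subspace_act g S)"
proof
  show "subspace_act g (vec.span S) \<subseteq> vec.span (subspace_act g S)"
    using assms by (intro subspace_act_span_subset) (auto simp: GammaL4_def)
  obtain h where h: "h \<in> carrier GammaL4" "\<And>x. semilin_apply h (semilin_apply g x) = x"
    "\<And>x. semilin_apply g (semilin_apply h x) = x"
    using GammaL4_inverse[OF assms] by blast
  have "subspace_act h (vec.span (subspace_act g S)) \<subseteq> vec.span (subspace_act h (subspace_act g S))"
    using h(1) by (intro subspace_act_span_subset) (auto simp: GammaL4_def)
  also have "subspace_act h (subspace_act g S) = S"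
    by (simp add: subspace_act_def image_image h)
  finally have "subspace_act g (subspace_act h (vec.span (subspace_act g S))) \<subseteq> subspace_act g (vec.span S)"
    unfolding subspace_act_def by (rule image_mono)
  then show "vec.span (subspace_act g S) \<subseteq> subspace_act g (vec.span S)"
    by (simp add: subspace_act_def image_image h)
qed

lemma subspace_subspace_act:
  assumes "g \<in> carrier GammaL4" "vec.subspace S"
  shows "vec.subspace (subspace_act g S)"
  using assms subspace_act_span[of g S] by (metis vec.span_eq_iff)

text \<open>The image of a basis spans the image. Its independence need not be checked, since
  equality of dimensions comes from applying this bound to the inverse.\<close>

lemma dim_subspace_act_le:
  assumes "g \<in> carrier GammaL4"
  shows "vec.dim (subspace_act g S) \<le> vec.dim S"
proof -
  obtain B where B: "B \<subseteq> S" "vec.independent B" "S \<subseteq> vec.span B" "card B = vec.dim S"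
    using vec.basis_exists by blast
  have fin: "finite B" using B(2) by (rule vec.finiteI_independent)
  have "subspace_act g S \<subseteq> vec.span (subspace_act g B)"
    using B(3) subspace_act_span[OF assms, of B] by (auto simp: subspace_act_def)
  then have "vec.dim (subspace_act g S) \<le> card (subspace_act g B)"
    using fin by (intro vec.dim_le_card) (auto simp: subspace_act_def)
  also have "\<dots> \<le> card B"
    unfolding subspace_act_def using fin by (rule card_image_le)
  finally show ?thesis using B(4) by simp
qed

lemma dim_subspace_act:
  assumes "g \<in> carrier GammaL4"
  shows "vec.dim (subspace_act g S) = vec.dim S"
proof (rule antisym[OF dim_subspace_act_le[OF assms]])
  obtain h where h: "h \<in> carrier GammaL4" "\<And>x. semilin_apply h (semilin_apply g x) = x"
    using GammaL4_inverse[OF assms] by metis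
  then have "subspace_act h (subspace_act g S) = S"
    by (simp add: subspace_act_def image_image)
  then show "vec.dim S \<le> vec.dim (subspace_act g S)"
    using dim_subspace_act_le[OF h(1), of "subspace_act g S"] by simp
qed

text \<open>Injective self-maps of the finite sets of points and lines are bijective, so it suffices that
  points go to points and lines to lines.\<close>
lemma payne_automorphismI:
  fixes g :: "'a::{field,finite} semilinear"
  assumes g: "g \<in> carrier GammaL4"
    and form: "\<And>x y. symp_form (semilin_apply g x) (semilin_apply g y) = snd g (symp_form x y)"
    and base: "subspace_act g base_point = base_point"
  shows "payne_automorphism g"
proof -
  have aut: "snd g \<in> field_auts" using g by (auto simp: GammaL4_def)
  \<comment> \<open>\<sigma> is injective and fixes 0, so orthogonality is preserved in both
    directions.\<close>
  have form0: "symp_form (semilin_apply g x) (semilin_apply g y) = 0 \<longleftrightarrow> symp_form x y = 0" for x y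
    unfolding form using field_autsD(1,2)[OF aut] by (metis bij_pointE)
  have perp: "subspace_act g Q \<subseteq> perp base_point \<longleftrightarrow> Q \<subseteq> perp base_point" for Q
  proof -
    have "subspace_act g Q \<subseteq> perp (subspace_act g base_point) \<longleftrightarrow> Q \<subseteq> perp base_point"
      by (auto simp: subspace_act_def perp_def form0)
    then show ?thesis by (simp only: base)
  qed
  have points: "subspace_act g Q \<in> payne_points" if "Q \<in> payne_points" for Q
    using that g
    by (simp add: payne_points_def proj_points_def perp subspace_subspace_act dim_subspace_act)
  have base_sub: "base_point \<subseteq> subspace_act g L \<longleftrightarrow> base_point \<subseteq> L" for L
  proof -
    have "subspace_act g base_point \<subseteq> subspace_act g L \<longleftrightarrow> base_point \<subseteq> L"
      by (simp add: subspace_act_def inj_image_subset_iff inj_semilin_apply[OF g])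
    then show ?thesis by (simp only: base)
  qed
  have lines: "subspace_act g L \<in> payne_lines" if L: "L \<in> payne_lines" for L
  \<comment> \<open>The two kinds of lines are treated separately. Each kind is mapped to itself
    because \<open>g\<close> fixes P and preserves orthogonality.\<close>
  proof (cases "L \<in> W_lines \<and> \<not> base_point \<subseteq> L")
    case True
    then have "subspace_act g L \<in> proj_lines"
      using g by (simp add: W_lines_def proj_lines_def subspace_subspace_act dim_subspace_act)
    moreover have "symp_form x y = 0" if "x \<in> subspace_act g L" "y \<in> subspace_act g L" for x y
      using that True form0 by (auto simp: W_lines_def subspace_act_def)
    ultimately show ?thesis
      using True base_sub by (simp add: payne_lines_def W_lines_def)
  next
    case False
    then obtain Q where Q: "Q \<in> payne_points" "L = vec.span (base_point \<union> Q)"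
      using L by (auto simp: payne_lines_def payne_points_def)
    have "subspace_act g L = vec.span (base_point \<union> subspace_act g Q)"
      unfolding Q(2) subspace_act_span[OF g]
      by (metis base image_Un subspace_act_def)
    then show ?thesis
      using points[OF Q(1)] by (auto simp: payne_lines_def payne_points_def)
  qed
  have "bij_betw (subspace_act g) X X" if "\<And>S. S \<in> X \<Longrightarrow> subspace_act g S \<in> X"
    for X :: "('a ^ 4) set set"
  proof -
    have inj: "inj_on (subspace_act g) X"
      using inj_subspace_act[OF g] by (rule inj_on_subset) simp
    moreover have "subspace_act g ` X = X"
      using that inj by (intro endo_inj_surj) auto
    ultimately show ?thesis by (simp add: bij_betw_def)
  qed
  then show ?thesis
    using points lines by (simp add: payne_automorphism_def)
qed

section \<open>Affine coordinates for the points of the Payne derived quadrangle\<close>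

text \<open>The hyperplane orthogonal to P is given by vanishing of the last coordinate, so a point
  outside it has a generator normalized to last coordinate 1.\<close>

lemma payne_points_eq: "payne_points = {vec.span {vector [a, b, c, 1]} | a b c. True}"
proof (intro equalityI subsetI)
  fix Q :: "('a ^ 4) set"
  assume "Q \<in> payne_points"
  then have sub: "vec.subspace Q" and dim: "vec.dim Q = 1" and perp: "\<not> Q \<subseteq> perp base_point"
    by (auto simp: payne_points_def proj_points_def)
  from perp obtain v k where v: "v \<in> Q" "symp_form (k *s vector [1, 0, 0, 0]) v \<noteq> 0"
    by (auto simp: perp_def base_point_def vec.span_singleton)
  then have v4: "v $ 4 \<noteq> 0" by (auto simp: symp_form_def)
  define x :: "'a ^ 4" where "x = vector [v $ 1 / v $ 4, v $ 2 / v $ 4, v $ 3 / v $ 4, 1]"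
  have "x = inverse (v $ 4) *s v"
    using v4 by (simp add: x_def vec_eq_iff forall_4 field_simps)
  then have "x \<in> Q" using vec.subspace_scale[OF sub v(1)] by simp
  moreover have "x \<noteq> 0" by (auto simp: x_def vec_eq_iff forall_4)
  \<comment> \<open>A nonzero vector is independent, hence already spans the one-dimensional
    \<open>Q\<close>.\<close>
  ultimately have "Q \<subseteq> vec.span {x}"
    using dim by (intro vec.card_ge_dim_independent) auto
  moreover have "vec.span {x} \<subseteq> Q"
    using \<open>x \<in> Q\<close> sub by (intro vec.span_minimal) auto
  ultimately show "Q \<in> {vec.span {vector [a, b, c, 1]} | a b c. True}"
    unfolding x_def by blast
next
  fix Q :: "('a ^ 4) set"
  assume "Q \<in> {vec.span {vector [a, b, c, 1]} | a b c. True}"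
  then obtain a b c where Q: "Q = vec.span {vector [a, b, c, 1]}" by blast
  let ?x = "vector [a, b, c, 1] :: 'a ^ 4" and ?e = "vector [1, 0, 0, 0] :: 'a ^ 4"
  have "?x \<noteq> 0" by (auto simp: vec_eq_iff forall_4)
  then have "vec.dim Q = 1" unfolding Q by (simp add: vec.dim_eq_card_independent)
  moreover have "?x \<in> Q" "?e \<in> base_point" "symp_form ?e ?x \<noteq> 0"
    by (simp_all add: Q base_point_def vec.span_base symp_form_def)
  ultimately show "Q \<in> payne_points"
    by (auto simp: payne_points_def proj_points_def perp_def Q)
qed

text \<open>Comparing the last coordinates forces the scalar between the two generators to be
  1.\<close>

lemma span_affine_eq_iff:
  "vec.span {vector [a, b, c, 1] :: 'a::field ^ 4} = vec.span {vector [x, y, z, 1]}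
    \<longleftrightarrow> a = x \<and> b = y \<and> c = z"
proof
  assume "vec.span {vector [a, b, c, 1] :: 'a ^ 4} = vec.span {vector [x, y, z, 1]}"
  then have "(vector [a, b, c, 1] :: 'a ^ 4) \<in> vec.span {vector [x, y, z, 1]}"
    by (metis insertI1 vec.span_base)
  then show "a = x \<and> b = y \<and> c = z"
    by (auto simp: vec.span_singleton vec_eq_iff forall_4)
qed simp

text \<open>The fourth unit vector is sent to the fourth row of the matrix.\<close>

lemma subspace_act_E_mat_origin:
  assumes "(E_mat a b c t, \<sigma>) \<in> carrier GammaL4"
  shows "subspace_act (E_mat a b c t, \<sigma>) (vec.span {vector [0, 0, 0, 1]}) =
    vec.span {vector [a, b, c, 1]}"
proof -
  have "\<sigma> \<in> field_auts" using assms by (auto simp: GammaL4_def)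
  then have "semilin_apply (E_mat a b c t, \<sigma>) (vector [0, 0, 0, 1]) = vector [a, b, c, 1]"
    by (simp add: semilin_apply_def E_mat_def vector_matrix_mult_def vec_eq_iff forall_4 sum_4
        field_autsD)
  then show ?thesis
    unfolding subspace_act_span[OF assms] by (simp add: subspace_act_def)
qed

lemma subspace_act_E_mat_base_point:
  assumes "(E_mat a b c t, \<sigma>) \<in> carrier GammaL4"
  shows "subspace_act (E_mat a b c t, \<sigma>) base_point = base_point"
proof -
  have "\<sigma> \<in> field_auts" using assms by (auto simp: GammaL4_def)
  then have "semilin_apply (E_mat a b c t, \<sigma>) (vector [1, 0, 0, 0]) = vector [1, 0, 0, 0]"
    by (simp add: semilin_apply_def E_mat_def vector_matrix_mult_def vec_eq_iff forall_4 sum_4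
        field_autsD)
  then show ?thesis
    unfolding base_point_def subspace_act_span[OF assms] by (simp add: subspace_act_def)
qed

section \<open>Finite subgroup criterion\<close>

text \<open>Left translation by an element of the finite set \<open>H\<close> is injective, hence
  onto \<open>H\<close>. Solving \<open>h \<otimes> k = h\<close> yields the identity, and then
  \<open>h \<otimes> k = \<one>\<close> yields the inverse.\<close>

lemma (in group) subgroupI_finite:
  assumes "H \<subseteq> carrier G" "H \<noteq> {}" "finite H"
    and closed: "\<And>x y. x \<in> H \<Longrightarrow> y \<in> H \<Longrightarrow> x \<otimes> y \<in> H"
  shows "subgroup H G"
proof -
  have solve: "\<exists>k\<in>H. h \<otimes> k = x" if h: "h \<in> H" and x: "x \<in> H" for h x
  proof -
    have "inj_on ((\<otimes>) h) H"
      using assms(1) h by (intro inj_onI) (metis Units_eq Units_l_cancel subsetD)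
    then have "(\<otimes>) h ` H = H"
      using assms(3) closed[OF h] by (intro endo_inj_surj) auto
    then show ?thesis using x by (metis imageE)
  qed
  have one: "\<one> \<in> H"
  proof -
    obtain h where "h \<in> H" using assms(2) by blast
    with solve obtain k where "k \<in> H" "h \<otimes> k = h" by blast
    then show ?thesis using assms(1) \<open>h \<in> H\<close> by (metis l_cancel_one subsetD)
  qed
  have "inv h \<in> H" if h: "h \<in> H" for h
  proof -
    obtain k where k: "k \<in> H" "h \<otimes> k = \<one>" using solve[OF h one] by blast
    then have "inv k = h" using assms(1) h by (intro inv_equality) auto
    then show ?thesis using inv_inv[of k] k(1) assms(1) by auto
  qed
  then show ?thesis using assms one by (intro subgroupI) auto
qed

section \<open>Closure under composition and regularity\<close>

theorem theorem2p1:
  fixes p m :: nat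
    and T :: "'a::{field,finite} \<times> 'a \<times> 'a \<Rightarrow> 'a"
    and \<theta> :: "'a \<times> 'a \<times> 'a \<Rightarrow> ('a \<Rightarrow> 'a)"
  assumes "prime p"
    and "CARD('a) = p ^ m"
    and "\<forall>a b c. \<theta> (a, b, c) \<in> field_auts"
  shows
    "(point_regular_group (G_set T \<theta>) \<longleftrightarrow>
       (\<forall>a b c x y z.
          let \<sigma> = \<theta> (x, y, z); t = T (x, y, z);
              w = \<sigma> c + z;
              v = \<sigma> b + y + \<sigma> c * t;
              u = \<sigma> a + x - \<sigma> b * z + \<sigma> c * y - \<sigma> c * z * t
          in semilin_comp (g_elem T \<theta> (a, b, c)) (g_elem T \<theta> (x, y, z)) = g_elem T \<theta> (u, v, w)))
     \<and>
     (\<forall>a b c x y z.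
          let \<sigma> = \<theta> (x, y, z); t = T (x, y, z);
              w = \<sigma> c + z;
              v = \<sigma> b + y + \<sigma> c * t;
              u = \<sigma> a + x - \<sigma> b * z + \<sigma> c * y - \<sigma> c * z * t
          in semilin_comp (g_elem T \<theta> (a, b, c)) (g_elem T \<theta> (x, y, z)) = g_elem T \<theta> (u, v, w)
             \<longleftrightarrow> aut_mult (\<theta> (a, b, c)) (\<theta> (x, y, z)) = \<theta> (u, v, w)
                 \<and> \<sigma> (T (a, b, c)) + T (x, y, z) = T (u, v, w))"
    (is "(_ \<longleftrightarrow> ?closed) \<and> ?equiv")
proof
  interpret group "GammaL4 :: 'a semilinear monoid" by (rule group_GammaL4)
  have mult: "semilin_comp = (\<otimes>\<^bsub>GammaL4\<^esub>)" by (simp add: GammaL4_def)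
  have aut: "\<theta> r \<in> field_auts" for r using assms(3) by (cases r) auto
  have carrier: "g \<in> carrier GammaL4" if "g \<in> G_set T \<theta>" for g
    using that g_elem_in_GammaL4[OF aut] by (auto simp: G_set_def)
  have comp: "semilin_comp (g_elem T \<theta> (a, b, c)) (g_elem T \<theta> (x, y, z)) =
      (E_mat (\<theta> (x, y, z) a + x - \<theta> (x, y, z) b * z + \<theta> (x, y, z) c * y - \<theta> (x, y, z) c * z * T (x, y, z))
        (\<theta> (x, y, z) b + y + \<theta> (x, y, z) c * T (x, y, z)) (\<theta> (x, y, z) c + z)
        (\<theta> (x, y, z) (T (a, b, c)) + T (x, y, z)), aut_mult (\<theta> (a, b, c)) (\<theta> (x, y, z)))"
    for a b c x y z
    by (simp add: g_elem_def semilin_comp_E_mat aut)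
  \<comment> \<open>The first three parameters of the product are literally \<open>u\<close>,
    \<open>v\<close>, \<open>w\<close>, so only the fourth parameter and the automorphism remain to
    be compared.\<close>
  show ?equiv
    unfolding Let_def comp by (auto simp: g_elem_def E_mat_eq_iff)
  show "point_regular_group (G_set T \<theta>) \<longleftrightarrow> ?closed"
  proof
    assume "point_regular_group (G_set T \<theta>)"
    then have sub: "subgroup (G_set T \<theta>) GammaL4" by (simp add: point_regular_group_def)
    have "semilin_comp (g_elem T \<theta> (a, b, c)) (g_elem T \<theta> (x, y, z)) \<in> G_set T \<theta>" for a b c x y z
      unfolding mult by (rule subgroup.m_closed[OF sub]) (auto simp: G_set_def)
    then have "\<exists>a' b' c'. semilin_comp (g_elem T \<theta> (a, b, c)) (g_elem T \<theta> (x, y, z)) = g_elem T \<theta> (a', b', c')"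
      for a b c x y z
      by (simp add: G_set_def)
    \<comment> \<open>The product is some \<open>g_elem\<close> with unknown index; comparing
      matrices forces that index to be \<open>(u, v, w)\<close>.\<close>
    then show ?closed
      unfolding Let_def comp by (simp add: g_elem_def E_mat_eq_iff)
  next
    assume closed: ?closed
    have sub: "subgroup (G_set T \<theta>) GammaL4"
    proof (rule subgroupI_finite)
      have "G_set T \<theta> = range (g_elem T \<theta>)" by (auto simp: G_set_def)
      then show "finite (G_set T \<theta>)" "G_set T \<theta> \<noteq> {}" by simp_all
      show "g \<otimes>\<^bsub>GammaL4\<^esub> h \<in> G_set T \<theta>" if "g \<in> G_set T \<theta>" "h \<in> G_set T \<theta>" for g h
        using that closed unfolding mult[symmetric] Let_def G_set_def by blast
    qed (use carrier in blast)
    let ?O = "vec.span {vector [0, 0, 0, 1]} :: ('a ^ 4) set"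
    have origin: "subspace_act (g_elem T \<theta> (a, b, c)) ?O = vec.span {vector [a, b, c, 1]}" for a b c
      using subspace_act_E_mat_origin g_elem_in_GammaL4[of \<theta> "(a, b, c)" T, OF aut]
      by (simp add: g_elem_def)
    have from_origin: "\<exists>g\<in>G_set T \<theta>. subspace_act g ?O = X" if "X \<in> payne_points" for X
      using that origin unfolding payne_points_eq G_set_def by blast
    have act_mult: "subspace_act (g \<otimes>\<^bsub>GammaL4\<^esub> h) X = subspace_act h (subspace_act g X)"
      if "h \<in> carrier GammaL4" for g h :: "'a semilinear" and X
      unfolding mult[symmetric] using that by (intro subspace_act_comp) (auto simp: GammaL4_def)
    \<comment> \<open>The identity acts injectively and its square is itself, so one application can
      be cancelled.\<close>
    have act_one: "subspace_act \<one>\<^bsub>GammaL4\<^esub> X = X" for X :: "('a ^ 4) set"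
      by (rule injD[OF inj_subspace_act[OF one_closed]]) (metis act_mult l_one one_closed)
    \<comment> \<open>Both \<open>g\<close> and the identity lie in the set and fix the origin
      \<open>?O\<close>, so both equal the element with index \<open>(0, 0, 0)\<close>.\<close>
    have stab: "g = \<one>\<^bsub>GammaL4\<^esub>" if g: "g \<in> G_set T \<theta>" "subspace_act g ?O = ?O" for g
    proof -
      have "h = g_elem T \<theta> (0, 0, 0)" if "h \<in> G_set T \<theta>" "subspace_act h ?O = ?O" for h
        using that by (auto simp: G_set_def origin span_affine_eq_iff)
      then show ?thesis using g act_one subgroup.one_closed[OF sub] by metis
    qed
    have "payne_automorphism g" if g: "g \<in> G_set T \<theta>" for g
    proof -
      obtain a b c where abc: "g = (E_mat a b c (T (a, b, c)), \<theta> (a, b, c))"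
        using g by (auto simp: G_set_def g_elem_def)
      show ?thesis
        using carrier[OF g] unfolding abc
        by (intro payne_automorphismI) (simp_all add: symp_form_E_mat aut subspace_act_E_mat_base_point)
    qed
    moreover have "\<exists>g\<in>G_set T \<theta>. subspace_act g X = Y"
      if XY: "X \<in> payne_points" "Y \<in> payne_points" for X Y
    proof -
      obtain g h where gh: "g \<in> G_set T \<theta>" "h \<in> G_set T \<theta>" "subspace_act g ?O = X" "subspace_act h ?O = Y"
        using from_origin[OF XY(1)] from_origin[OF XY(2)] by blast
      \<comment> \<open>In the right action this product first takes \<open>X\<close> back to the
        origin and then moves the origin to \<open>Y\<close>.\<close>
      let ?k = "inv\<^bsub>GammaL4\<^esub> g \<otimes>\<^bsub>GammaL4\<^esub> h"
      have k: "?k \<in> G_set T \<theta>"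
        using sub gh by (simp add: subgroup.m_closed subgroup.m_inv_closed)
      have "g \<otimes>\<^bsub>GammaL4\<^esub> ?k = h"
        using carrier gh by (simp add: m_assoc[symmetric])
      then have "subspace_act ?k X = Y"
        using act_mult[OF carrier[OF k], of g ?O] gh by simp
      then show ?thesis using k by blast
    qed
    moreover have "g = \<one>\<^bsub>GammaL4\<^esub>"
      if "X \<in> payne_points" and g: "g \<in> G_set T \<theta>" and fix_X: "subspace_act g X = X" for X g
    proof -
      obtain h where h: "h \<in> G_set T \<theta>" "subspace_act h ?O = X" using from_origin \<open>X \<in> payne_points\<close> by blast
      \<comment> \<open>Conjugation reduces the stabilizer of \<open>X\<close> to that of the
        origin: \<open>h\<close> takes the origin to \<open>X\<close>, \<open>g\<close> fixes
        \<open>X\<close>, and the inverse of \<open>h\<close> returns to the origin.\<close>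
      let ?k = "h \<otimes>\<^bsub>GammaL4\<^esub> g \<otimes>\<^bsub>GammaL4\<^esub> inv\<^bsub>GammaL4\<^esub> h"
      have car: "g \<in> carrier GammaL4" "h \<in> carrier GammaL4" using carrier g h by auto
      have k: "?k \<in> G_set T \<theta>"
        using sub g h by (simp add: subgroup.m_closed subgroup.m_inv_closed)
      have "subspace_act ?k ?O = subspace_act (h \<otimes>\<^bsub>GammaL4\<^esub> inv\<^bsub>GammaL4\<^esub> h) ?O"
        using car h fix_X by (simp only: act_mult inv_closed)
      then have "?k = \<one>\<^bsub>GammaL4\<^esub>" using stab[OF k] car act_one by simp
      \<comment> \<open>Since the conjugate is trivial, \<open>h \<otimes> g\<close> is the inverse
        of the inverse of \<open>h\<close>, which is \<open>h\<close> itself.\<close>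
      then have "h \<otimes>\<^bsub>GammaL4\<^esub> g = h"
        using car inv_equality[of "h \<otimes>\<^bsub>GammaL4\<^esub> g" "inv\<^bsub>GammaL4\<^esub> h"] by simp
      then show ?thesis using car by simp
    qed
    ultimately show "point_regular_group (G_set T \<theta>)"
      using sub by (simp add: point_regular_group_def)
  qed
qed

end
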